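(* There is an absolute constant $C$ such that the following holds. Let $(P,\sigma)$ be a continuous orthonormal system and let $f:\mathbb{R}^+\to\mathbb{C}$ be a measurable function with $$L:=\int_{\mathbb{R}^+}|f(r)|^2\log^2(2+r)\,dr<\infty .$$ Then the sequence $\left\{\int_0^n f(r)P(r,k)\,dr\right\}_{n\in\mathbb{N}}$ converges for $\sigma$-a.e. $k\in\mathbb{R}$. Moreover, if $$M(k):=\sup_{n\in\mathbb{N}}\left|\int_0^n f(r)P(r,k)\,dr\right|,$$ then $\|M\|_{L^2_\sigma(\mathbb{R})}\le C L^{1/2}$.
   Context: $\mathbb{R}^+=[0,\infty)$. $L^2_{\rm loc}(\mathbb{R}^+)$ is the set of $g$ with $\int_0^a|g(r)|^2dr<\infty$ for all $a>0$. A pair $(P,\sigma)$, consisting of a (jointly measurable) function $P(r,k):\mathbb{R}^+\times\mathbb{R}\to\mathbb{C}$ and a (Borel) measure $\sigma$ on $\mathbb{R}$, is called a continuous orthonormal system if (a) for $\sigma$-a.e. $k\in\mathbb{R}$, the function $r\mapsto P(r,k)$ belongs to $L^2_{\rm loc}(\mathbb{R}^+)$; (b) for every $f\in L^2(\mathbb{R}^+)$ and every $a>0$, $$\int_{\mathbb{R}}\left|\int_0^a f(r)P(r,k)\,dr\right|^2d\sigma(k)=\int_0^a|f(r)|^2dr .$$ *)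

theory Defs
  imports "HOL-Analysis.Analysis"
begin

text \<open>
  Functions on the half-line \<open>[0,\<infinity>)\<close> are represented by functions on \<open>real\<close> of which only the
  restriction to \<open>{0..}\<close> matters.  Integrals that may a priori be infinite are taken in
  \<open>ennreal\<close>, since the Bochner integral of a non-integrable function is \<open>0\<close> by convention.
\<close>

definition L2_halfline :: "(real \<Rightarrow> complex) set" where
  "L2_halfline = {g \<in> borel_measurable (lebesgue_on {0..}).
     (\<integral>\<^sup>+r\<in>{0..}. ennreal ((cmod (g r))\<^sup>2) \<partial>lebesgue) < \<infinity>}"

definition L2_loc_halfline :: "(real \<Rightarrow> complex) set" where
  "L2_loc_halfline = {g \<in> borel_measurable (lebesgue_on {0..}).
     \<forall>a>0. (\<integral>\<^sup>+r\<in>{0..a}. ennreal ((cmod (g r))\<^sup>2) \<partial>lebesgue) < \<infinity>}"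

definition partial_int :: "(real \<Rightarrow> real \<Rightarrow> complex) \<Rightarrow> (real \<Rightarrow> complex) \<Rightarrow> real \<Rightarrow> real \<Rightarrow> complex" where
  "partial_int P f a k = (LINT r:{0..a}|lebesgue. f r * P r k)"

text \<open>
  Joint measurability refers to the product of the Lebesgue sigma-algebra in \<open>r\<close> and the Borel
  sigma-algebra in \<open>k\<close>; this includes all jointly Borel functions.  The measure \<open>\<sigma>\<close> is an
  arbitrary Borel measure, not assumed to be finite or sigma-finite.
\<close>

definition continuous_orthonormal_system :: "(real \<Rightarrow> real \<Rightarrow> complex) \<Rightarrow> real measure \<Rightarrow> bool" where
  "continuous_orthonormal_system P \<sigma> \<longleftrightarrow>
     sets \<sigma> = sets borel \<and>
     (\<lambda>(r, k). P r k) \<in> borel_measurable (lebesgue_on {0..} \<Otimes>\<^sub>M \<sigma>) \<and>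
     (AE k in \<sigma>. (\<lambda>r. P r k) \<in> L2_loc_halfline) \<and>
     (\<forall>f\<in>L2_halfline. \<forall>a>0.
        (\<integral>\<^sup>+k. ennreal ((cmod (partial_int P f a k))\<^sup>2) \<partial>\<sigma>) =
        (\<integral>\<^sup>+r\<in>{0..a}. ennreal ((cmod (f r))\<^sup>2) \<partial>lebesgue))"

definition log_energy :: "(real \<Rightarrow> complex) \<Rightarrow> ennreal" where
  "log_energy f = (\<integral>\<^sup>+r\<in>{0..}. ennreal ((cmod (f r))\<^sup>2 * (ln (2 + r))\<^sup>2) \<partial>lebesgue)"

definition maximal_fun :: "(real \<Rightarrow> real \<Rightarrow> complex) \<Rightarrow> (real \<Rightarrow> complex) \<Rightarrow> real \<Rightarrow> ennreal" where
  "maximal_fun P f k = (SUP n::nat. ennreal (cmod (partial_int P f (real n) k)))"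

definition sqrt_ennreal :: "ennreal \<Rightarrow> ennreal" where
  "sqrt_ennreal x = (if x = \<infinity> then \<infinity> else ennreal (sqrt (enn2real x)))"

definition L2_norm :: "real measure \<Rightarrow> (real \<Rightarrow> ennreal) \<Rightarrow> ennreal" where
  "L2_norm \<sigma> F = sqrt_ennreal (\<integral>\<^sup>+k. (F k)\<^sup>2 \<partial>\<sigma>)"

end

theory Submission
  imports Defs
begin

text \<open>
  This is the Rademacher--Menshov argument.  Applying (b) to the restriction of \<open>f\<close> to \<open>(a,b]\<close>,
  the partial integrals \<open>S\<^sub>n\<close> satisfy \<open>\<integral>|S\<^sub>b - S\<^sub>a|\<^sup>2 d\<sigma> = c\<^sub>a + \<dots> + c\<^sub>b\<^sub>-\<^sub>1\<close>, where \<open>c\<^sub>j\<close> is the integral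
  of \<open>|f|\<^sup>2\<close> over \<open>(j,j+1]\<close>.  Splitting \<open>{a..a+n}\<close>
  with \<open>n \<le> 2\<^sup>m\<close> into at most one dyadic interval per scale bounds \<open>|S\<^sub>a\<^sub>+\<^sub>n - S\<^sub>a|\<^sup>2\<close> by \<open>m+1\<close> times
  the sum of all squared dyadic increments, whose integral costs a further factor \<open>m+1\<close>.  On the
  block \<open>[2\<^sup>m,2\<^sup>m\<^sup>+\<^sup>1)\<close> the loss \<open>(m+1)\<^sup>2\<close> is absorbed by the logarithmic weight; along \<open>S\<^sub>n\<close> with
  \<open>n = 2\<^sup>m\<close>, the same weight and Cauchy--Schwarz against \<open>\<Sum> 1/(m+1)\<^sup>2\<close> control the increments.
\<close>

section \<open>Dyadic increments and the chaining bound\<close>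

text \<open>At every scale only the left half of each interval contributes, and unit intervals enter
  at the bottom: a walk from \<open>a\<close> to \<open>a + n\<close> uses a left half exactly when
  it passes a midpoint, and never jumps over a whole right half.\<close>

primrec dyadic_energy :: "(nat \<Rightarrow> 'b::real_normed_vector) \<Rightarrow> nat \<Rightarrow> nat \<Rightarrow> real" where
  "dyadic_energy s 0 a = (norm (s (Suc a) - s a))\<^sup>2"
| "dyadic_energy s (Suc m) a =
     (norm (s (a + 2 ^ m) - s a))\<^sup>2 + dyadic_energy s m a + dyadic_energy s m (a + 2 ^ m)"

lemma dyadic_energy_nonneg: "0 \<le> dyadic_energy s m a"
  by (induction m arbitrary: a) auto

text \<open>A two-term Cauchy--Schwarz inequality with a free weight. Taking
  \<open>t = m + 1\<close> raises the constant in the following induction from \<open>m + 1\<close>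
  to \<open>m + 2\<close>; equal weights would double it at each scale.\<close>

lemma square_add_le_weighted:
  fixes x y :: real
  assumes "t > 0"
  shows "(x + y)\<^sup>2 \<le> (1 + t) * (x\<^sup>2 + y\<^sup>2 / t)"
proof -
  have "(1 + t) * (x\<^sup>2 + y\<^sup>2 / t) - (x + y)\<^sup>2 = (t * x - y)\<^sup>2 / t"
    using assms by (simp add: field_simps power2_eq_square)
  also have "\<dots> \<ge> 0"
    using assms by simp
  finally show ?thesis by simp
qed

text \<open>Induction on the scale: either \<open>a + n\<close> stays in the left half, or one
  left-half increment reaches the midpoint and the rest of the walk lies in the right half.\<close>

lemma norm_diff_le_dyadic_energy:
  assumes "n \<le> 2 ^ m"
  shows "(norm (s (a + n) - s a))\<^sup>2 \<le> real (Suc m) * dyadic_energy s m a"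
  using assms
proof (induction m arbitrary: n a)
  case 0
  then have "n = 0 \<or> n = 1" by auto
  then show ?case by auto
next
  case (Suc m)
  show ?case
  proof (cases "n \<le> 2 ^ m")
    case True
    have "(norm (s (a + n) - s a))\<^sup>2 \<le> real (Suc m) * dyadic_energy s m a"
      using Suc.IH[OF True] .
    also have "\<dots> \<le> real (Suc (Suc m)) * dyadic_energy s (Suc m) a"
      by (intro mult_mono) (auto simp: dyadic_energy_nonneg)
    finally show ?thesis .
  next
    case False
    let ?b = "a + 2 ^ m"
    define x where "x = norm (s ?b - s a)"
    define y where "y = norm (s (?b + (n - 2 ^ m)) - s ?b)"
    have eq: "?b + (n - 2 ^ m) = a + n"
      using False by simp
    have "norm (s (a + n) - s a) \<le> x + y"
      unfolding x_def y_def eq by (metis add.commute diff_add_cancel diff_add_eq norm_triangle_ineq)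
    then have "(norm (s (a + n) - s a))\<^sup>2 \<le> (x + y)\<^sup>2"
      by (intro power_mono) auto
    also have "\<dots> \<le> (1 + real (Suc m)) * (x\<^sup>2 + y\<^sup>2 / real (Suc m))"
      by (intro square_add_le_weighted) auto
    also have "y\<^sup>2 / real (Suc m) \<le> dyadic_energy s m ?b"
    proof -
      have "y\<^sup>2 \<le> real (Suc m) * dyadic_energy s m ?b"
        unfolding y_def using Suc.prems by (intro Suc.IH) auto
      then show ?thesis by (simp add: pos_divide_le_eq mult.commute)
    qed
    also have "x\<^sup>2 + dyadic_energy s m ?b \<le> dyadic_energy s (Suc m) a"
      by (auto simp: x_def dyadic_energy_nonneg)
    finally show ?thesis by (simp add: mult_left_mono)
  qed
qed

lemma sum_inverse_squares_le: "(\<Sum>i<m. 1 / (real (Suc i))\<^sup>2) \<le> 2"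
proof (cases m)
  case (Suc l)
  \<comment> \<open>The bound is sharpened to make the induction close: each new term is at most a
    telescoping difference of reciprocals.\<close>
  have "(\<Sum>i<Suc l. 1 / (real (Suc i))\<^sup>2) \<le> 2 - 1 / real (Suc l)" for l
  proof (induction l)
    case (Suc l)
    have "1 / (real (Suc (Suc l)))\<^sup>2 \<le> 1 / real (Suc l) - 1 / real (Suc (Suc l))"
      by (simp add: divide_simps power2_eq_square)
    with Suc show ?case by simp
  qed simp
  from this[of l] show ?thesis using Suc by (smt (verit) divide_nonneg_nonneg of_nat_0_le_iff)
qed simp

section \<open>Pointwise consequences: convergence and the maximal bound\<close>

text \<open>The first summand controls the jump across the block, with a weight that makes the jumps
  summable; the second controls oscillation inside the block. After integration both cost
  \<open>(m + 1)^2\<close> times the same sum.\<close>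

definition block_energy :: "(nat \<Rightarrow> 'b::real_normed_vector) \<Rightarrow> nat \<Rightarrow> real" where
  "block_energy s m = (real (Suc m))\<^sup>2 * (norm (s (2 ^ Suc m) - s (2 ^ m)))\<^sup>2
     + real (Suc m) * dyadic_energy s m (2 ^ m)"

lemma block_energy_nonneg: "0 \<le> block_energy s m"
  by (simp add: block_energy_def dyadic_energy_nonneg)

lemma block_energy_ge:
  shows "(real (Suc m))\<^sup>2 * (norm (s (2 ^ Suc m) - s (2 ^ m)))\<^sup>2 \<le> block_energy s m"
    and "\<lbrakk>2 ^ m \<le> n; n \<le> 2 ^ Suc m\<rbrakk> \<Longrightarrow> (norm (s n - s (2 ^ m)))\<^sup>2 \<le> block_energy s m"
proof -
  show "(real (Suc m))\<^sup>2 * (norm (s (2 ^ Suc m) - s (2 ^ m)))\<^sup>2 \<le> block_energy s m"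
    by (simp add: block_energy_def dyadic_energy_nonneg)
  assume n: "2 ^ m \<le> n" "n \<le> 2 ^ Suc m"
  then have "(norm (s (2 ^ m + (n - 2 ^ m)) - s (2 ^ m)))\<^sup>2
      \<le> real (Suc m) * dyadic_energy s m (2 ^ m)"
    by (intro norm_diff_le_dyadic_energy) auto
  then show "(norm (s n - s (2 ^ m)))\<^sup>2 \<le> block_energy s m"
    using n by (simp add: block_energy_def add_increasing)
qed

text \<open>The jumps between consecutive powers of two are absolutely summable, so that subsequence
  converges. Inside a block the deviation is at most the root of the block energy, which tends to
  0.\<close>

lemma convergent_if_summable_block_energy:
  fixes s :: "nat \<Rightarrow> 'b::banach"
  assumes "summable (block_energy s)"
  shows "convergent s"
proof -
  have bound: "norm (s (2 ^ Suc m) - s (2 ^ m)) \<le> 1 / (real (Suc m))\<^sup>2 + block_energy s m" for m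
  proof -
    define d where "d = norm (s (2 ^ Suc m) - s (2 ^ m))"
    \<comment> \<open>AM-GM for the product of \<open>1 / (m + 1)\<close> and
      \<open>(m + 1) * d\<close>: it passes from weighted squares of the jumps to the jumps
      themselves.\<close>
    have "0 \<le> (1 / real (Suc m) - real (Suc m) * d)\<^sup>2"
      by simp
    also have "\<dots> = 1 / (real (Suc m))\<^sup>2 - 2 * d + (real (Suc m))\<^sup>2 * d\<^sup>2"
      by (simp add: power2_diff power_divide power_mult_distrib del: of_nat_Suc)
    also have "\<dots> \<le> 1 / (real (Suc m))\<^sup>2 - 2 * d + block_energy s m"
      using block_energy_ge(1)[of m s] by (simp add: d_def)
    finally have "2 * d \<le> 1 / (real (Suc m))\<^sup>2 + block_energy s m" by simp
    moreover have "d \<ge> 0" by (simp add: d_def)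
    ultimately show ?thesis unfolding d_def[symmetric] by linarith
  qed
  have "summable (\<lambda>m. 1 / (real (Suc m))\<^sup>2)"
    using inverse_squares_sums by (simp add: sums_iff add.commute)
  then have "summable (\<lambda>m. 1 / (real (Suc m))\<^sup>2 + block_energy s m)"
    by (intro summable_add assms)
  then have "summable (\<lambda>m. s (2 ^ Suc m) - s (2 ^ m))"
    by (rule summable_comparison_test') (rule bound)
  then have "convergent (\<lambda>m. s (2 ^ m) - s (2 ^ 0))"
    by (simp only: summable_iff_convergent sum_lessThan_telescope[of "\<lambda>m. s (2 ^ m)"])
  then have "convergent (\<lambda>m. s (2 ^ m))"
    using convergent_add_const_right_iff[of "\<lambda>m. s (2 ^ m)" "- s (2 ^ 0)"] by simp
  then obtain l where l: "(\<lambda>m. s (2 ^ m)) \<longlonglongrightarrow> l"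
    by (auto simp: convergent_def)
  have b0: "(\<lambda>m. sqrt (block_energy s m)) \<longlonglongrightarrow> 0"
    using tendsto_real_sqrt[OF summable_LIMSEQ_zero[OF assms]] by simp
  have "s \<longlonglongrightarrow> l"
  proof (rule LIMSEQ_I)
    fix e :: real assume "e > 0"
    then have "e / 2 > 0" by simp
    from LIMSEQ_D[OF l this] LIMSEQ_D[OF b0 this] obtain M1 M2
      where M1: "\<And>m. m \<ge> M1 \<Longrightarrow> norm (s (2 ^ m) - l) < e / 2"
        and M2: "\<And>m. m \<ge> M2 \<Longrightarrow> norm (sqrt (block_energy s m) - 0) < e / 2"
      by blast
    show "\<exists>N. \<forall>n\<ge>N. norm (s n - l) < e"
    proof (intro exI allI impI)
      \<comment> \<open>Any such \<open>n\<close> lies in a block whose index \<open>m\<close> is at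
        least both \<open>M1\<close> and \<open>M2\<close>.\<close>
      fix n :: nat assume n: "2 ^ max M1 M2 \<le> n"
      then have "n \<ge> 1" by (metis one_le_numeral one_le_power order_trans)
      then obtain m where m: "2 ^ m \<le> n" "n < 2 ^ (m + 1)"
        using ex_power_ivl1[of 2 n] by auto
      have "2 ^ max M1 M2 < (2::nat) ^ (m + 1)"
        using n m by linarith
      then have "max M1 M2 < m + 1"
        by (simp only: power_strict_increasing_iff one_less_numeral_iff semiring_norm)
      then have mM: "M1 \<le> m" "M2 \<le> m" by auto
      have "norm (s n - s (2 ^ m)) \<le> sqrt (block_energy s m)"
        using m by (intro real_le_rsqrt block_energy_ge(2)) auto
      also have "\<dots> < e / 2"
        using M2[OF mM(2)] by simp
      finally show "norm (s n - l) < e"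
        using M1[OF mM(1)] by (metis dist_norm dist_triangle_half_l dist_commute)
    qed
  qed
  then show ?thesis by (rule convergentI)
qed

text \<open>Chaining: \<open>s n\<close> is reached from \<open>s 1\<close> by jumps along powers of
  two and one deviation inside the last block. The constant 6 is 3, for squaring three terms, times
  2, the bound on the sum of inverse squares.\<close>

lemma norm_square_le_block_energy:
  fixes s :: "nat \<Rightarrow> 'b::real_normed_vector"
  assumes "2 ^ m \<le> n" "n \<le> 2 ^ Suc m"
  shows "(norm (s n))\<^sup>2 \<le> 6 * ((norm (s 1))\<^sup>2 + (\<Sum>i\<le>m. block_energy s i))"
proof -
  define d where "d i = norm (s (2 ^ Suc i) - s (2 ^ i))" for i
  define B where "B = (\<Sum>i<m. block_energy s i)"
  have "norm (s (2 ^ m)) \<le> norm (s 1) + (\<Sum>i<m. d i)" for m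
  proof (induction m)
    case (Suc m)
    have "norm (s (2 ^ Suc m)) \<le> norm (s (2 ^ m)) + d m"
      unfolding d_def by (metis add.commute diff_add_cancel norm_triangle_ineq)
    with Suc show ?case by simp
  qed simp
  then have "norm (s n) \<le> norm (s 1) + (\<Sum>i<m. d i) + norm (s n - s (2 ^ m))"
    by (smt (verit) norm_triangle_sub)
  then have "(norm (s n))\<^sup>2 \<le> (norm (s 1) + (\<Sum>i<m. d i) + norm (s n - s (2 ^ m)))\<^sup>2"
    by (intro power_mono) auto
  also have "\<dots> \<le> 3 * ((norm (s 1))\<^sup>2 + (\<Sum>i<m. d i)\<^sup>2 + (norm (s n - s (2 ^ m)))\<^sup>2)"
  proof -
    have "3 * (x\<^sup>2 + y\<^sup>2 + z\<^sup>2) = (x + y + z)\<^sup>2 + ((x - y)\<^sup>2 + (y - z)\<^sup>2 + (x - z)\<^sup>2)"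
      for x y z :: real
      by (simp add: power2_eq_square algebra_simps)
    then show ?thesis by simp
  qed
  also have "(\<Sum>i<m. d i)\<^sup>2 \<le> 2 * B"
  proof -
    \<comment> \<open>The factors \<open>i + 1\<close> are inserted to pair the inverse squares with
      the weighted jumps in Cauchy--Schwarz.\<close>
    have "(\<Sum>i<m. d i)\<^sup>2 = (\<Sum>i<m. 1 / real (Suc i) * (real (Suc i) * d i))\<^sup>2"
      by (simp del: of_nat_Suc)
    also have "\<dots> \<le> (\<Sum>i<m. (1 / real (Suc i))\<^sup>2) * (\<Sum>i<m. (real (Suc i) * d i)\<^sup>2)"
      by (rule Cauchy_Schwarz_ineq_sum)
    also have "\<dots> \<le> 2 * B"
      unfolding B_def using block_energy_ge(1)[of _ s] sum_inverse_squares_le[of m]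
      by (intro mult_mono sum_mono)
        (auto simp: power_divide power_mult_distrib d_def sum_nonneg simp del: of_nat_Suc)
    finally show ?thesis .
  qed
  also have "(norm (s n - s (2 ^ m)))\<^sup>2 \<le> block_energy s m"
    using assms by (rule block_energy_ge(2))
  also have "3 * ((norm (s 1))\<^sup>2 + 2 * B + block_energy s m)
      \<le> 6 * ((norm (s 1))\<^sup>2 + (\<Sum>i\<le>m. block_energy s i))"
    using block_energy_nonneg[of s m]
    by (simp add: B_def lessThan_Suc_atMost[symmetric])
  finally show ?thesis by simp
qed

text \<open>A single majorant for both conclusions, extended-valued so that summability need not be
  known in advance. The term with \<open>s 1\<close> covers the step from 0 to 1, which belongs to
  no dyadic block.\<close>

definition total_energy :: "(nat \<Rightarrow> 'b::real_normed_vector) \<Rightarrow> ennreal" where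
  "total_energy s = ennreal ((norm (s 1))\<^sup>2) + (\<Sum>m. ennreal (block_energy s m))"

lemma convergent_if_total_energy_finite:
  fixes s :: "nat \<Rightarrow> 'b::banach"
  assumes "total_energy s \<noteq> \<infinity>"
  shows "convergent s"
  using assms
  by (intro convergent_if_summable_block_energy summable_suminf_not_top)
    (auto simp: total_energy_def block_energy_nonneg)

text \<open>The squared supremum is a supremum of products \<open>a m * a n\<close>, and each
  product is at most the larger of the two squares.\<close>

lemma SUP_square_le_ennreal:
  fixes a :: "nat \<Rightarrow> ennreal"
  assumes "\<And>n. (a n)\<^sup>2 \<le> B"
  shows "(SUP n. a n)\<^sup>2 \<le> B"
proof -
  have "a m * a n \<le> B" for m n
    using assms[of m] assms[of n]
    by (metis linear mult_left_mono mult_right_mono order_trans power2_eq_square zero_le)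
  then show ?thesis
    by (simp add: power2_eq_square SUP_mult_left_ennreal SUP_mult_right_ennreal SUP_le_iff)
qed

lemma SUP_norm_square_le_total_energy:
  fixes s :: "nat \<Rightarrow> 'b::real_normed_vector"
  assumes "s 0 = 0"
  shows "(SUP n. ennreal (norm (s n)))\<^sup>2 \<le> 6 * total_energy s"
proof -
  have "(ennreal (norm (s n)))\<^sup>2 \<le> 6 * total_energy s" for n
  proof (cases "n = 0")
    \<comment> \<open>Each positive index lies in a dyadic block; index 0 does not, and is settled
      by \<open>s 0 = 0\<close>.\<close>
    case False
    then obtain m where m: "2 ^ m \<le> n" "n < 2 ^ (m + 1)"
      using ex_power_ivl1[of 2 n] by auto
    have "(ennreal (norm (s n)))\<^sup>2 = ennreal ((norm (s n))\<^sup>2)"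
      by (simp add: ennreal_power)
    also have "\<dots> \<le> ennreal (6 * ((norm (s 1))\<^sup>2 + (\<Sum>i\<le>m. block_energy s i)))"
      using m by (intro ennreal_leI norm_square_le_block_energy) auto
    also have "\<dots> = 6 * (ennreal ((norm (s 1))\<^sup>2) + (\<Sum>i\<le>m. ennreal (block_energy s i)))"
      by (simp add: ennreal_mult ennreal_plus sum_nonneg block_energy_nonneg sum_ennreal)
    also have "\<dots> \<le> 6 * total_energy s"
      unfolding total_energy_def by (intro mult_left_mono add_left_mono sum_le_suminf) auto
    finally show ?thesis .
  qed (use assms in simp)
  then show ?thesis by (rule SUP_square_le_ennreal)
qed

section \<open>Integrated estimates: an abstract Rademacher--Menshov theorem\<close>

lemma dyadic_energy_measurable [measurable]:
  fixes S :: "nat \<Rightarrow> 'a \<Rightarrow> 'b::{real_normed_vector, second_countable_topology}"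
  assumes [measurable]: "\<And>n. S n \<in> borel_measurable M"
  shows "(\<lambda>x. dyadic_energy (\<lambda>n. S n x) m a) \<in> borel_measurable M"
  by (induction m arbitrary: a) simp_all

text \<open>For positive \<open>m\<close> one has \<open>m + 1 <= 2 * m\<close>, and
  \<open>m * ln 2\<close> is the logarithm of \<open>2 ^ m\<close>. This lets the logarithmic weight
  pay for the number of scales.\<close>

lemma Suc_le_log:
  assumes "2 ^ m \<le> j"
  shows "real (Suc m) \<le> 2 / ln 2 * ln (2 + real j)"
proof (cases "m = 0")
  case True
  have "ln 2 \<le> ln (2 + real j)" by simp
  then have "ln 2 \<le> 2 * ln (2 + real j)"
    using ln_gt_zero[of "2::real"] by linarith
  then show ?thesis using True by (simp add: field_simps)
next
  case False
  have "real (Suc m) * ln 2 \<le> 2 * (real m * ln 2)"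
    using False by (simp add: field_simps)
  also have "real m * ln 2 = ln (2 ^ m)" by (simp add: ln_realpow)
  also have "\<dots> \<le> ln (2 + real j)"
  proof -
    have "(2::real) ^ m \<le> real j"
      using assms by (metis of_nat_le_iff of_nat_numeral of_nat_power)
    then show ?thesis by (smt (verit) ln_le_cancel_iff zero_less_power)
  qed
  finally show ?thesis using ln_gt_zero[of "2::real"] by (simp add: field_simps)
qed

text \<open>Orthogonality enters as a bound on increments that is additive over the index interval.
  The constant is \<open>6 * 3 * 4 / (ln 2)^2\<close>: 6 from the pointwise chaining, 3 = 1 + 2 from
  the first step and the blocks, and the square of \<open>2 / ln 2\<close> from comparing scales
  with logarithms.\<close>

theorem Rademacher_Menshov:
  fixes S :: "nat \<Rightarrow> 'a \<Rightarrow> 'b::{banach, second_countable_topology}"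
    and c :: "nat \<Rightarrow> ennreal"
  defines "W \<equiv> (\<Sum>j. c j * ennreal ((ln (2 + real j))\<^sup>2))"
  assumes meas [measurable]: "\<And>n. S n \<in> borel_measurable M"
    and zero: "\<And>x. S 0 x = 0"
    and incr: "\<And>a b. a \<le> b \<Longrightarrow>
      (\<integral>\<^sup>+x. ennreal ((norm (S b x - S a x))\<^sup>2) \<partial>M) \<le> (\<Sum>j=a..<b. c j)"
    and fin: "W < \<infinity>"
  shows "AE x in M. convergent (\<lambda>n. S n x)"
    and "(\<integral>\<^sup>+x. (SUP n. ennreal (norm (S n x)))\<^sup>2 \<partial>M) \<le> ennreal (72 / (ln 2)\<^sup>2) * W"
proof -
  let ?s = "\<lambda>x n. S n x"
  define w where "w j = c j * ennreal ((ln (2 + real j))\<^sup>2)" for j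
  \<comment> \<open>The intervals of one scale are disjoint, so each of the \<open>m + 1\<close>
    scales contributes at most the full sum of the \<open>c j\<close>.\<close>
  have energy: "(\<integral>\<^sup>+x. ennreal (dyadic_energy (?s x) m a) \<partial>M) \<le> of_nat (Suc m) * (\<Sum>j=a..<a + 2 ^ m. c j)"
    for m a
  proof (induction m arbitrary: a)
    case 0
    then show ?case using incr[of a "Suc a"] by simp
  next
    case (Suc m)
    let ?b = "a + 2 ^ m" and ?d = "a + 2 ^ Suc m"
    have split: "(\<Sum>j=a..<?d. c j) = (\<Sum>j=a..<?b. c j) + (\<Sum>j=?b..<?b + 2 ^ m. c j)"
      by (subst sum.atLeastLessThan_concat) (auto simp: mult_2 add.assoc)
    have "(\<integral>\<^sup>+x. ennreal (dyadic_energy (?s x) (Suc m) a) \<partial>M) =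
        (\<integral>\<^sup>+x. ennreal ((norm (S ?b x - S a x))\<^sup>2) \<partial>M)
        + (\<integral>\<^sup>+x. ennreal (dyadic_energy (?s x) m a) \<partial>M)
        + (\<integral>\<^sup>+x. ennreal (dyadic_energy (?s x) m ?b) \<partial>M)"
      by (simp add: dyadic_energy_nonneg nn_integral_add)
    also have "\<dots> \<le> (\<Sum>j=a..<?d. c j) + of_nat (Suc m) * (\<Sum>j=a..<?b. c j)
        + of_nat (Suc m) * (\<Sum>j=?b..<?b + 2 ^ m. c j)"
    proof (intro add_mono Suc.IH)
      have "(\<integral>\<^sup>+x. ennreal ((norm (S ?b x - S a x))\<^sup>2) \<partial>M) \<le> (\<Sum>j=a..<?b. c j)"
        by (rule incr) simp
      also have "\<dots> \<le> (\<Sum>j=a..<?d. c j)"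
        unfolding split by simp
      finally show "(\<integral>\<^sup>+x. ennreal ((norm (S ?b x - S a x))\<^sup>2) \<partial>M) \<le> (\<Sum>j=a..<?d. c j)" .
    qed
    also have "\<dots> = of_nat (Suc (Suc m)) * (\<Sum>j=a..<?d. c j)"
      unfolding split by (simp add: algebra_simps)
    finally show ?case .
  qed
  \<comment> \<open>The logarithmic comparison is left as a premise because it is also used for
    \<open>m = 0\<close> and \<open>j = 0\<close>, where \<open>2 ^ m \<le> j\<close> fails.\<close>
  have c_le: "(of_nat (Suc m))\<^sup>2 * c j \<le> ennreal (4 / (ln 2)\<^sup>2) * w j"
    if "real (Suc m) \<le> 2 / ln 2 * ln (2 + real j)" for m j
  proof -
    have "(of_nat (Suc m) :: ennreal)\<^sup>2 = ennreal ((real (Suc m))\<^sup>2)"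
      by (metis ennreal_of_nat_eq_real_of_nat of_nat_power)
    also have "\<dots> \<le> ennreal ((2 / ln 2 * ln (2 + real j))\<^sup>2)"
      using that by (intro ennreal_leI power_mono) auto
    also have "\<dots> = ennreal (4 / (ln 2)\<^sup>2) * ennreal ((ln (2 + real j))\<^sup>2)"
      by (simp add: power_mult_distrib power_divide flip: ennreal_mult)
    finally show ?thesis
      unfolding w_def by (metis (no_types, lifting) mult.assoc mult.commute mult_right_mono zero_le)
  qed
  have block: "(\<integral>\<^sup>+x. ennreal (block_energy (?s x) m) \<partial>M)
      \<le> 2 * ennreal (4 / (ln 2)\<^sup>2) * (\<Sum>j=2 ^ m..<2 ^ Suc m. w j)" for m
  proof -
    let ?n = "of_nat (Suc m) :: ennreal" and ?c = "\<Sum>j=2 ^ m..<2 ^ Suc m. c j"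
    have "(\<integral>\<^sup>+x. ennreal (block_energy (?s x) m) \<partial>M) =
      (\<integral>\<^sup>+x. ?n\<^sup>2 * ennreal ((norm (S (2 ^ Suc m) x - S (2 ^ m) x))\<^sup>2)
         + ?n * ennreal (dyadic_energy (?s x) m (2 ^ m)) \<partial>M)"
      unfolding block_energy_def
      by (simp add: dyadic_energy_nonneg ennreal_mult ennreal_power ennreal_of_nat_eq_real_of_nat
          del: of_nat_Suc power_Suc)
    also have "\<dots> = ?n\<^sup>2 * (\<integral>\<^sup>+x. ennreal ((norm (S (2 ^ Suc m) x - S (2 ^ m) x))\<^sup>2) \<partial>M)
        + ?n * (\<integral>\<^sup>+x. ennreal (dyadic_energy (?s x) m (2 ^ m)) \<partial>M)"
      by (simp add: nn_integral_add nn_integral_cmult del: of_nat_Suc power_Suc)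
    \<comment> \<open>In the second summand one factor comes from the pointwise chaining and the
      other from integrating the dyadic energy.\<close>
    also have "\<dots> \<le> ?n\<^sup>2 * ?c + ?n * (?n * ?c)"
      using energy[of m "2 ^ m"] incr[of "2 ^ m" "2 ^ Suc m"]
      by (intro add_mono mult_left_mono) (auto simp: mult_2)
    also have "\<dots> = 2 * (\<Sum>j=2 ^ m..<2 ^ Suc m. ?n\<^sup>2 * c j)"
      by (simp add: power2_eq_square mult_2 mult.assoc sum_distrib_left[symmetric] del: of_nat_Suc power_Suc)
    also have "\<dots> \<le> 2 * (\<Sum>j=2 ^ m..<2 ^ Suc m. ennreal (4 / (ln 2)\<^sup>2) * w j)"
      by (intro mult_left_mono sum_mono c_le Suc_le_log) auto
    finally show ?thesis by (simp add: sum_distrib_left mult.assoc)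
  qed
  have total_measurable [measurable]: "(\<lambda>x. total_energy (?s x)) \<in> borel_measurable M"
    unfolding total_energy_def block_energy_def by measurable
  have total: "(\<integral>\<^sup>+x. total_energy (?s x) \<partial>M) \<le> 3 * ennreal (4 / (ln 2)\<^sup>2) * W"
  proof -
    \<comment> \<open>\<open>S 1\<close> is rewritten as \<open>S 1 - S 0\<close>, so that the
      increment hypothesis bounds it by \<open>c 0\<close>.\<close>
    have "(\<integral>\<^sup>+x. total_energy (?s x) \<partial>M) = (\<integral>\<^sup>+x. ennreal ((norm (S 1 x - S 0 x))\<^sup>2) \<partial>M)
        + (\<Sum>m. \<integral>\<^sup>+x. ennreal (block_energy (?s x) m) \<partial>M)"
      unfolding total_energy_def block_energy_def
      by (simp add: nn_integral_add nn_integral_suminf zero)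
    also have "\<dots> \<le> ennreal (4 / (ln 2)\<^sup>2) * W + 2 * ennreal (4 / (ln 2)\<^sup>2) * W"
    proof (rule add_mono)
      have "(\<integral>\<^sup>+x. ennreal ((norm (S 1 x - S 0 x))\<^sup>2) \<partial>M) \<le> c 0"
        using incr[of 0 1] by simp
      also have "c 0 \<le> ennreal (4 / (ln 2)\<^sup>2) * w 0"
        using c_le[of 0 0] by simp
      also have "w 0 \<le> W"
        using sum_le_suminf[of w "{0}"] by (simp add: W_def flip: w_def)
      finally show "(\<integral>\<^sup>+x. ennreal ((norm (S 1 x - S 0 x))\<^sup>2) \<partial>M) \<le> ennreal (4 / (ln 2)\<^sup>2) * W"
        by (simp add: mult_left_mono)
      have "(\<Sum>m<N. \<Sum>j=2 ^ m..<2 ^ Suc m. w j) \<le> W" for N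
      proof -
        \<comment> \<open>The blocks tile the indices from 1 up to \<open>2 ^ N\<close>, so no
          weight is counted twice.\<close>
        have "(\<Sum>m<N. \<Sum>j=2 ^ m..<2 ^ Suc m. w j) = (\<Sum>j=1..<2 ^ N. w j)"
        proof (induction N)
          case (Suc N)
          then show ?case by (simp add: sum.atLeastLessThan_concat del: power_Suc)
        qed simp
        also have "\<dots> \<le> W"
          unfolding W_def w_def[symmetric] by (intro sum_le_suminf) auto
        finally show ?thesis .
      qed
      then have blocks: "(\<Sum>m. \<Sum>j=2 ^ m..<2 ^ Suc m. w j) \<le> W"
        by (intro suminf_le_const) auto
      have "(\<Sum>m. \<integral>\<^sup>+x. ennreal (block_energy (?s x) m) \<partial>M)
          \<le> (\<Sum>m. 2 * ennreal (4 / (ln 2)\<^sup>2) * (\<Sum>j=2 ^ m..<2 ^ Suc m. w j))"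
        by (intro suminf_le block) auto
      also have "\<dots> = 2 * ennreal (4 / (ln 2)\<^sup>2) * (\<Sum>m. \<Sum>j=2 ^ m..<2 ^ Suc m. w j)"
        by (rule ennreal_suminf_cmult)
      also have "\<dots> \<le> 2 * ennreal (4 / (ln 2)\<^sup>2) * W"
        using blocks by (intro mult_left_mono) auto
      finally show "(\<Sum>m. \<integral>\<^sup>+x. ennreal (block_energy (?s x) m) \<partial>M)
          \<le> 2 * ennreal (4 / (ln 2)\<^sup>2) * W" .
    qed
    also have "\<dots> = (1 + 2) * ennreal (4 / (ln 2)\<^sup>2) * W"
      by (simp only: distrib_right mult_1)
    finally show ?thesis by simp
  qed
  have "(\<integral>\<^sup>+x. total_energy (?s x) \<partial>M) \<noteq> \<infinity>"
  proof -
    have "3 * ennreal (4 / (ln 2)\<^sup>2) * W < \<infinity>"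
      using fin by (simp add: ennreal_mult_less_top)
    with total show ?thesis by (auto simp: top_unique)
  qed
  then have "AE x in M. total_energy (?s x) \<noteq> \<infinity>"
    by (intro nn_integral_PInf_AE total_measurable)
  then show "AE x in M. convergent (?s x)"
    by eventually_elim (rule convergent_if_total_energy_finite)
  have "(\<integral>\<^sup>+x. (SUP n. ennreal (norm (S n x)))\<^sup>2 \<partial>M) \<le> (\<integral>\<^sup>+x. 6 * total_energy (?s x) \<partial>M)"
    by (intro nn_integral_mono SUP_norm_square_le_total_energy zero)
  also have "\<dots> = 6 * (\<integral>\<^sup>+x. total_energy (?s x) \<partial>M)"
    by (rule nn_integral_cmult) simp
  also have "\<dots> \<le> 6 * (3 * ennreal (4 / (ln 2)\<^sup>2) * W)"
    using total by (intro mult_left_mono) auto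
  also have "\<dots> = ennreal (72 / (ln 2)\<^sup>2) * W"
  proof -
    have "(6::ennreal) * (3 * ennreal (4 / (ln 2)\<^sup>2)) = ennreal (72 / (ln 2)\<^sup>2)"
      by (simp flip: ennreal_numeral ennreal_mult)
    then show ?thesis by (metis mult.assoc)
  qed
  finally show "(\<integral>\<^sup>+x. (SUP n. ennreal (norm (S n x)))\<^sup>2 \<partial>M) \<le> ennreal (72 / (ln 2)\<^sup>2) * W" .
qed

section \<open>Partial integrals of a continuous orthonormal system\<close>

lemma borel_measurable_lebesgue_on_subset:
  fixes f :: "'a::euclidean_space \<Rightarrow> 'b::euclidean_space"
  assumes "f \<in> borel_measurable (lebesgue_on T)" "S \<subseteq> T" "S \<in> sets lebesgue"
  shows "(\<lambda>x. indicator S x *\<^sub>R f x) \<in> borel_measurable lebesgue"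
proof -
  have "f \<in> borel_measurable (lebesgue_on S)"
    using measurable_restrict_mono[OF assms(1,2)] .
  then show ?thesis
    using borel_measurable_restrict_space_iff[of S lebesgue f] assms(3) by simp
qed

lemma partial_int_eq_integral_lebesgue_on:
  "partial_int P f a k = (LINT r|lebesgue_on {0..a}. f r * P r k)"
  by (simp add: partial_int_def set_lebesgue_integral_def integral_restrict_space)

text \<open>Measurability of a parameter integral asks for sigma-finiteness only of the measure
  integrated against. This is Lebesgue measure on a bounded interval, so \<open>\<sigma>\<close> may
  be arbitrary.\<close>

lemma partial_int_measurable:
  assumes P: "(\<lambda>(r, k). P r k) \<in> borel_measurable (lebesgue_on {0..} \<Otimes>\<^sub>M \<sigma>)"
    and f: "f \<in> borel_measurable (lebesgue_on {0..})"
  shows "partial_int P f a \<in> borel_measurable \<sigma>"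
proof -
  let ?M = "lebesgue_on {0..a}"
  interpret finite_measure ?M
    by (rule finite_measure_lebesgue_on) simp
  have id [measurable]: "(\<lambda>r. r) \<in> ?M \<rightarrow>\<^sub>M lebesgue_on {0..}"
    by (rule measurable_restrict_mono[of _ _ "{0..}"]) auto
  have [measurable]: "f \<in> borel_measurable ?M"
    using measurable_compose[OF id f] .
  have "(\<lambda>(k, r). (r, k)) \<in> \<sigma> \<Otimes>\<^sub>M ?M \<rightarrow>\<^sub>M lebesgue_on {0..} \<Otimes>\<^sub>M \<sigma>"
    by measurable
  from measurable_compose[OF this P] have [measurable]: "(\<lambda>(k, r). P r k) \<in> borel_measurable (\<sigma> \<Otimes>\<^sub>M ?M)"
    by (simp add: case_prod_beta')
  have "(\<lambda>k. LINT r|?M. f r * P r k) \<in> borel_measurable \<sigma>"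
    by measurable
  then show ?thesis
    by (simp add: partial_int_eq_integral_lebesgue_on[abs_def])
qed

text \<open>The product is dominated by the sum of the two squares. Integrability matters because
  the Bochner integral is 0 by default otherwise, and would not be additive.\<close>

lemma set_integrable_mult_L2:
  assumes f: "f \<in> L2_loc_halfline" and g: "g \<in> L2_loc_halfline" and "a > 0"
  shows "set_integrable lebesgue {0..a} (\<lambda>r. f r * g r)"
proof -
  let ?M = "lebesgue_on {0..a}"
  have [measurable]: "f \<in> borel_measurable ?M" "g \<in> borel_measurable ?M"
    using f g by (auto simp: L2_loc_halfline_def elim: measurable_restrict_mono)
  have fin: "(\<integral>\<^sup>+r. ennreal ((cmod (h r))\<^sup>2) \<partial>?M) < \<infinity>" if "h \<in> L2_loc_halfline" for h
    using that \<open>a > 0\<close> by (simp add: L2_loc_halfline_def nn_integral_restrict_space)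
  have "(\<integral>\<^sup>+r. ennreal (norm (f r * g r)) \<partial>?M)
      \<le> (\<integral>\<^sup>+r. ennreal ((cmod (f r))\<^sup>2) + ennreal ((cmod (g r))\<^sup>2) \<partial>?M)"
  proof (rule nn_integral_mono)
    fix r
    have "norm (f r * g r) \<le> (cmod (f r))\<^sup>2 + (cmod (g r))\<^sup>2"
      using sum_squares_bound[of "cmod (f r)" "cmod (g r)"]
        mult_nonneg_nonneg[OF norm_ge_zero[of "f r"] norm_ge_zero[of "g r"]]
      unfolding norm_mult by linarith
    then show "ennreal (norm (f r * g r)) \<le> ennreal ((cmod (f r))\<^sup>2) + ennreal ((cmod (g r))\<^sup>2)"
      by (simp flip: ennreal_plus)
  qed
  also have "\<dots> = (\<integral>\<^sup>+r. ennreal ((cmod (f r))\<^sup>2) \<partial>?M) + (\<integral>\<^sup>+r. ennreal ((cmod (g r))\<^sup>2) \<partial>?M)"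
    by (rule nn_integral_add) auto
  also have "\<dots> < \<infinity>"
    using fin[OF f] fin[OF g] by simp
  finally have "integrable ?M (\<lambda>r. f r * g r)"
    by (simp add: integrable_iff_bounded)
  then show ?thesis
    by (simp add: set_integrable_def integrable_restrict_space)
qed

lemma L2_halfline_subset_loc: "L2_halfline \<subseteq> L2_loc_halfline"
proof -
  have "(\<integral>\<^sup>+r\<in>{0..a}. ennreal ((cmod (g r))\<^sup>2) \<partial>lebesgue)
      \<le> (\<integral>\<^sup>+r\<in>{0..}. ennreal ((cmod (g r))\<^sup>2) \<partial>lebesgue)" for g :: "real \<Rightarrow> complex" and a
    by (intro nn_integral_mono) (auto split: split_indicator)
  then show ?thesis
    by (auto simp: L2_halfline_def L2_loc_halfline_def intro: le_less_trans)
qed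

lemma indicator_scaleR_L2_halfline:
  assumes f: "f \<in> L2_halfline" and [measurable]: "A \<in> sets borel"
  shows "(\<lambda>r. indicator A r *\<^sub>R f r) \<in> L2_halfline"
proof -
  have [measurable]: "f \<in> borel_measurable (lebesgue_on {0..})"
    using f by (simp add: L2_halfline_def)
  have "indicat_real A \<in> borel_measurable lebesgue"
    by (intro borel_measurable_indicator) simp
  then have [measurable]: "indicat_real A \<in> borel_measurable (lebesgue_on {0..})"
    by (rule measurable_restrict_space1)
  have "(\<integral>\<^sup>+r\<in>{0..}. ennreal ((cmod (indicator A r *\<^sub>R f r))\<^sup>2) \<partial>lebesgue)
      \<le> (\<integral>\<^sup>+r\<in>{0..}. ennreal ((cmod (f r))\<^sup>2) \<partial>lebesgue)"
    by (intro nn_integral_mono) (auto split: split_indicator)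
  also have "\<dots> < \<infinity>"
    using f by (simp add: L2_halfline_def)
  finally show ?thesis
    by (simp add: L2_halfline_def)
qed

text \<open>Writing an increment as a partial integral of the truncated function brings it into the
  form to which the isometry (b) applies.\<close>

lemma partial_int_diff:
  assumes "f \<in> L2_halfline" "(\<lambda>r. P r k) \<in> L2_loc_halfline" "0 \<le> a" "a \<le> b"
  shows "partial_int P f b k - partial_int P f a k
    = partial_int P (\<lambda>r. indicator {a<..b} r *\<^sub>R f r) b k"
proof (cases "a = b")
  \<comment> \<open>Treated apart because \<open>a = b = 0\<close> is possible, while the
    integrability lemma asks for a positive endpoint.\<close>
  case True
  then show ?thesis by (simp add: partial_int_def set_lebesgue_integral_def)
next
  case False
  then have b: "set_integrable lebesgue {0..b} (\<lambda>r. f r * P r k)"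
    using assms L2_halfline_subset_loc by (intro set_integrable_mult_L2) auto
  then have a: "set_integrable lebesgue {0..a} (\<lambda>r. f r * P r k)"
    by (rule set_integrable_subset) (use assms in auto)
  have "partial_int P f b k - partial_int P f a k
      = (LINT r|lebesgue. indicator {0..b} r *\<^sub>R (f r * P r k) - indicator {0..a} r *\<^sub>R (f r * P r k))"
    unfolding partial_int_def set_lebesgue_integral_def
    using a b by (intro Bochner_Integration.integral_diff[symmetric]) (auto simp: set_integrable_def)
  also have "\<dots> = partial_int P (\<lambda>r. indicator {a<..b} r *\<^sub>R f r) b k"
    unfolding partial_int_def set_lebesgue_integral_def
    using assms by (intro Bochner_Integration.integral_cong) (auto split: split_indicator)
  finally show ?thesis .
qed

lemma nn_integral_partial_int_diff:
  assumes sys: "continuous_orthonormal_system P \<sigma>" and f: "f \<in> L2_halfline"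
    and "0 \<le> a" "a \<le> b"
  shows "(\<integral>\<^sup>+k. ennreal ((cmod (partial_int P f b k - partial_int P f a k))\<^sup>2) \<partial>\<sigma>)
    = (\<integral>\<^sup>+r\<in>{a<..b}. ennreal ((cmod (f r))\<^sup>2) \<partial>lebesgue)"
proof (cases "a = b")
  case False
  let ?g = "\<lambda>r. indicator {a<..b} r *\<^sub>R f r"
  have "AE k in \<sigma>. (\<lambda>r. P r k) \<in> L2_loc_halfline"
    using sys by (simp add: continuous_orthonormal_system_def)
  then have "(\<integral>\<^sup>+k. ennreal ((cmod (partial_int P f b k - partial_int P f a k))\<^sup>2) \<partial>\<sigma>)
      = (\<integral>\<^sup>+k. ennreal ((cmod (partial_int P ?g b k))\<^sup>2) \<partial>\<sigma>)"
    using assms by (intro nn_integral_cong_AE) (auto simp: partial_int_diff)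
  also have "\<dots> = (\<integral>\<^sup>+r\<in>{0..b}. ennreal ((cmod (?g r))\<^sup>2) \<partial>lebesgue)"
    using sys indicator_scaleR_L2_halfline[OF f, of "{a<..b}"] assms(3,4) False
    by (simp add: continuous_orthonormal_system_def)
  also have "\<dots> = (\<integral>\<^sup>+r\<in>{a<..b}. ennreal ((cmod (f r))\<^sup>2) \<partial>lebesgue)"
    using assms by (intro nn_integral_cong) (auto split: split_indicator)
  finally show ?thesis .
qed simp

section \<open>Unit intervals and the logarithmic weight\<close>

lemma sum_nn_integral_unit_intervals:
  fixes h :: "real \<Rightarrow> ennreal"
  assumes h: "(\<lambda>r. h r * indicator {0..} r) \<in> borel_measurable lebesgue" and "a \<le> b"
  shows "(\<Sum>j=a..<b. \<integral>\<^sup>+r\<in>{real j<..real (Suc j)}. h r \<partial>lebesgue)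
    = (\<integral>\<^sup>+r\<in>{real a<..real b}. h r \<partial>lebesgue)"
  using \<open>a \<le> b\<close>
proof (induction b rule: dec_induct)
  case (step n)
  have meas: "(\<lambda>r. h r * indicator {real i<..real j} r) \<in> borel_measurable lebesgue" for i j
  proof -
    have "indicator {real i<..real j} \<in> borel_measurable lebesgue"
      by (intro borel_measurable_indicator) simp
    \<comment> \<open>The interval lies in the half-line, so the extra indicator, which supplies the
      measurability, changes nothing.\<close>
    with h have "(\<lambda>r. h r * indicator {0..} r * indicator {real i<..real j} r) \<in> borel_measurable lebesgue"
      by (rule borel_measurable_times_ennreal)
    also have "(\<lambda>r. h r * indicator {0..} r * indicator {real i<..real j} r)
        = (\<lambda>r. h r * indicator {real i<..real j} r)"
      by (auto split: split_indicator)
    finally show ?thesis .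
  qed
  have "(\<integral>\<^sup>+r\<in>{real a<..real (Suc n)}. h r \<partial>lebesgue) =
      (\<integral>\<^sup>+r. h r * indicator {real a<..real n} r + h r * indicator {real n<..real (Suc n)} r \<partial>lebesgue)"
    using step(1) by (intro nn_integral_cong) (auto split: split_indicator)
  also have "\<dots> = (\<integral>\<^sup>+r\<in>{real a<..real n}. h r \<partial>lebesgue)
      + (\<integral>\<^sup>+r\<in>{real n<..real (Suc n)}. h r \<partial>lebesgue)"
    by (intro nn_integral_add meas)
  finally show ?case using step by simp
qed simp

text \<open>On the half-line the weight is at least \<open>(ln 2)^2\<close>, which is
  positive.\<close>

lemma L2_halfline_if_log_energy_finite:
  assumes f: "f \<in> borel_measurable (lebesgue_on {0..})" and fin: "log_energy f < \<infinity>"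
  shows "f \<in> L2_halfline"
proof -
  let ?l = "ennreal ((ln 2)\<^sup>2)"
  have "(\<lambda>r. indicator {0..} r *\<^sub>R f r) \<in> borel_measurable lebesgue"
    using f by (rule borel_measurable_lebesgue_on_subset) auto
  then have "(\<lambda>r. ennreal ((cmod (indicator {0..} r *\<^sub>R f r))\<^sup>2)) \<in> borel_measurable lebesgue"
    by measurable
  also have "(\<lambda>r. ennreal ((cmod (indicator {0..} r *\<^sub>R f r))\<^sup>2))
      = (\<lambda>r. ennreal ((cmod (f r))\<^sup>2) * indicator {0..} r)"
    by (auto split: split_indicator)
  finally have "?l * (\<integral>\<^sup>+r\<in>{0..}. ennreal ((cmod (f r))\<^sup>2) \<partial>lebesgue)
      = (\<integral>\<^sup>+r. ?l * (ennreal ((cmod (f r))\<^sup>2) * indicator {0..} r) \<partial>lebesgue)"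
    by (rule nn_integral_cmult[symmetric])
  also have "\<dots> \<le> log_energy f"
    unfolding log_energy_def
  proof (intro nn_integral_mono)
    fix r :: real
    show "?l * (ennreal ((cmod (f r))\<^sup>2) * indicator {0..} r)
        \<le> ennreal ((cmod (f r))\<^sup>2 * (ln (2 + r))\<^sup>2) * indicator {0..} r"
      by (auto split: split_indicator simp: mult.commute power_mono mult_left_mono
          simp flip: ennreal_mult intro!: ennreal_leI)
  qed
  finally have "?l * (\<integral>\<^sup>+r\<in>{0..}. ennreal ((cmod (f r))\<^sup>2) \<partial>lebesgue) < \<infinity>"
    using fin by (rule le_less_trans)
  then show ?thesis
    using f by (auto simp: L2_halfline_def ennreal_mult_less_top)
qed

text \<open>The logarithm is increasing, so on each unit interval its value at the left endpoint is
  a lower bound for the weight.\<close>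

lemma suminf_log_weighted_le_log_energy:
  assumes f: "f \<in> borel_measurable (lebesgue_on {0..})"
  shows "(\<Sum>j. (\<integral>\<^sup>+r\<in>{real j<..real (Suc j)}. ennreal ((cmod (f r))\<^sup>2) \<partial>lebesgue)
      * ennreal ((ln (2 + real j))\<^sup>2)) \<le> log_energy f"
    (is "(\<Sum>j. ?c j * ?w j) \<le> _")
proof -
  let ?h = "\<lambda>r. ennreal ((cmod (f r))\<^sup>2 * (ln (2 + r))\<^sup>2)"
  have ind: "(\<lambda>r. indicator A r *\<^sub>R f r) \<in> borel_measurable lebesgue"
    if "A \<subseteq> {0..}" "A \<in> sets borel" for A
    using f that by (intro borel_measurable_lebesgue_on_subset) auto
  have [measurable]: "(\<lambda>r::real. ln (2 + r)) \<in> borel_measurable lebesgue"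
    by (rule measurable_completion) simp
  have "(\<lambda>r. ennreal ((cmod (indicator {0..} r *\<^sub>R f r))\<^sup>2 * (ln (2 + r))\<^sup>2)) \<in> borel_measurable lebesgue"
    using ind[of "{0..}"] by measurable
  also have "(\<lambda>r. ennreal ((cmod (indicator {0..} r *\<^sub>R f r))\<^sup>2 * (ln (2 + r))\<^sup>2))
      = (\<lambda>r. ?h r * indicator {0..} r)"
    by (auto split: split_indicator)
  finally have meas: "(\<lambda>r. ?h r * indicator {0..} r) \<in> borel_measurable lebesgue" .
  have term_le: "?c j * ?w j \<le> (\<integral>\<^sup>+r\<in>{real j<..real (Suc j)}. ?h r \<partial>lebesgue)" for j
  proof -
    have [measurable]: "(\<lambda>r. indicator {real j<..real (Suc j)} r *\<^sub>R f r) \<in> borel_measurable lebesgue"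
      by (rule ind) auto
    have "(\<lambda>r. ennreal ((cmod (indicator {real j<..real (Suc j)} r *\<^sub>R f r))\<^sup>2)) \<in> borel_measurable lebesgue"
      by measurable
    also have "(\<lambda>r. ennreal ((cmod (indicator {real j<..real (Suc j)} r *\<^sub>R f r))\<^sup>2))
        = (\<lambda>r. ennreal ((cmod (f r))\<^sup>2) * indicator {real j<..real (Suc j)} r)"
      by (auto split: split_indicator)
    finally have "?c j * ?w j
        = (\<integral>\<^sup>+r. ennreal ((cmod (f r))\<^sup>2) * indicator {real j<..real (Suc j)} r * ?w j \<partial>lebesgue)"
      by (rule nn_integral_multc[symmetric])
    also have "\<dots> \<le> (\<integral>\<^sup>+r\<in>{real j<..real (Suc j)}. ?h r \<partial>lebesgue)"
      by (intro nn_integral_mono)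
        (auto split: split_indicator intro!: ennreal_leI mult_left_mono power_mono simp flip: ennreal_mult)
    finally show ?thesis .
  qed
  have "(\<Sum>j<n. ?c j * ?w j) \<le> log_energy f" for n
  proof -
    have "(\<Sum>j<n. ?c j * ?w j) \<le> (\<Sum>j<n. \<integral>\<^sup>+r\<in>{real j<..real (Suc j)}. ?h r \<partial>lebesgue)"
      by (intro sum_mono term_le)
    also have "\<dots> = (\<integral>\<^sup>+r\<in>{0<..real n}. ?h r \<partial>lebesgue)"
      using sum_nn_integral_unit_intervals[OF meas, of 0 n] by (simp add: atLeast0LessThan)
    also have "\<dots> \<le> log_energy f"
      unfolding log_energy_def by (intro nn_integral_mono) (auto split: split_indicator)
    finally show ?thesis .
  qed
  then show ?thesis by (intro suminf_le_const) auto
qed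

section \<open>Passage to norms and conclusion\<close>

lemma sqrt_ennreal_le_mult:
  assumes "x \<le> ennreal B * y" "y < \<infinity>" "0 \<le> B"
  shows "sqrt_ennreal x \<le> ennreal (sqrt B) * sqrt_ennreal y"
proof -
  obtain v where v: "y = ennreal v" "0 \<le> v"
    using assms(2) by (cases y) auto
  obtain u where u: "x = ennreal u" "0 \<le> u"
    using assms(1) v \<open>0 \<le> B\<close> by (cases x) (auto simp: top_unique simp flip: ennreal_mult)
  have "u \<le> B * v"
    using assms v u by (simp flip: ennreal_mult)
  then have "sqrt u \<le> sqrt B * sqrt v"
    by (simp flip: real_sqrt_mult)
  then show ?thesis
    using assms u v by (simp add: sqrt_ennreal_def flip: ennreal_mult)
qed

theorem theorem1p2:
  shows "\<exists>C::real. C > 0 \<and>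
    (\<forall>(P::real \<Rightarrow> real \<Rightarrow> complex) (\<sigma>::real measure) (f::real \<Rightarrow> complex).
       continuous_orthonormal_system P \<sigma> \<longrightarrow>
       f \<in> borel_measurable (lebesgue_on {0..}) \<longrightarrow>
       log_energy f < \<infinity> \<longrightarrow>
       (AE k in \<sigma>. convergent (\<lambda>n::nat. partial_int P f (real n) k)) \<and>
       L2_norm \<sigma> (maximal_fun P f) \<le> ennreal C * sqrt_ennreal (log_energy f))"
proof (intro exI conjI allI impI)
  \<comment> \<open>\<open>?B\<close> bounds second moments; the constant for norms is its square
    root.\<close>
  let ?B = "72 / (ln 2)\<^sup>2 :: real"
  show "0 < sqrt ?B" by simp
  fix P :: "real \<Rightarrow> real \<Rightarrow> complex" and \<sigma> :: "real measure" and f :: "real \<Rightarrow> complex"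
  assume sys: "continuous_orthonormal_system P \<sigma>"
    and f: "f \<in> borel_measurable (lebesgue_on {0..})"
    and fin: "log_energy f < \<infinity>"
  define c where "c j = (\<integral>\<^sup>+r\<in>{real j<..real (Suc j)}. ennreal ((cmod (f r))\<^sup>2) \<partial>lebesgue)" for j
  let ?S = "\<lambda>n. partial_int P f (real n)" and ?W = "\<Sum>j. c j * ennreal ((ln (2 + real j))\<^sup>2)"
  have W: "?W \<le> log_energy f"
    unfolding c_def by (rule suminf_log_weighted_le_log_energy[OF f])
  have L2: "f \<in> L2_halfline"
    using f fin by (rule L2_halfline_if_log_energy_finite)
  have meas: "?S n \<in> borel_measurable \<sigma>" for n
    using sys f by (intro partial_int_measurable) (auto simp: continuous_orthonormal_system_def)
  have zero: "?S 0 k = 0" for k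
  proof -
    \<comment> \<open>The integration range is a single point, a null set.\<close>
    have "AE r in lebesgue. indicator {0..real 0} r *\<^sub>R (f r * P r k) = 0"
      by (rule AE_I'[of "{0}"]) (auto simp: null_sets_completionI split: split_indicator)
    then show ?thesis
      unfolding partial_int_def set_lebesgue_integral_def by (rule integral_eq_zero_AE)
  qed
  have "(\<lambda>r. indicator {0..} r *\<^sub>R f r) \<in> borel_measurable lebesgue"
    using f by (rule borel_measurable_lebesgue_on_subset) auto
  then have "(\<lambda>r. ennreal ((cmod (indicator {0..} r *\<^sub>R f r))\<^sup>2)) \<in> borel_measurable lebesgue"
    by measurable
  also have "(\<lambda>r. ennreal ((cmod (indicator {0..} r *\<^sub>R f r))\<^sup>2))
      = (\<lambda>r. ennreal ((cmod (f r))\<^sup>2) * indicator {0..} r)"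
    by (auto split: split_indicator)
  finally have "(\<Sum>j=a..<b. c j) = (\<integral>\<^sup>+r\<in>{real a<..real b}. ennreal ((cmod (f r))\<^sup>2) \<partial>lebesgue)"
    if "a \<le> b" for a b
    unfolding c_def using that by (rule sum_nn_integral_unit_intervals)
  then have incr: "(\<integral>\<^sup>+k. ennreal ((cmod (?S b k - ?S a k))\<^sup>2) \<partial>\<sigma>) \<le> (\<Sum>j=a..<b. c j)"
    if "a \<le> b" for a b
    using nn_integral_partial_int_diff[OF sys L2, of "real a" "real b"] that by simp
  have W_fin: "?W < \<infinity>"
    using W fin by (rule le_less_trans)
  show "AE k in \<sigma>. convergent (\<lambda>n. ?S n k)"
    using meas zero incr W_fin by (rule Rademacher_Menshov(1))
  have "(\<integral>\<^sup>+k. (maximal_fun P f k)\<^sup>2 \<partial>\<sigma>) \<le> ennreal ?B * ?W"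
    unfolding maximal_fun_def using meas zero incr W_fin by (rule Rademacher_Menshov(2))
  also have "\<dots> \<le> ennreal ?B * log_energy f"
    using W by (rule mult_left_mono) simp
  finally show "L2_norm \<sigma> (maximal_fun P f) \<le> ennreal (sqrt ?B) * sqrt_ennreal (log_energy f)"
    unfolding L2_norm_def using fin by (rule sqrt_ennreal_le_mult) simp
qed

end
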